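(* Let $V = \{0,\ldots,n-1\}$ be a set of $n$ items partitioned into two unknown clusters $R$ and $B$ (with $0 \le |R| \le n$). Let $0 < \delta < 1$ and $L = \frac{\log n}{\log\log n}$. Suppose that querying a pair of items $x,y$ (each pair at most once) returns whether $x$ and $y$ are in the same cluster, the answer being correct with probability $\frac{1+\delta}{2}$ and incorrect with probability $q = \frac{1-\delta}{2}$, independently across queries. Then there exists a polynomial time algorithm that performs $O\!\left(\frac{n\log n}{\delta^{L}}\right)$ queries and recovers the clustering $(R,B)$ (as an unlabeled partition) with probability tending to $1$ as $n\to\infty$.
   Context: Only the partition $\{R,B\}$ must be recovered, not which part is labeled red or blue. *)

theory Defs
  imports "HOL-Probability.Probability" "HOL-Computational_Algebra.Polynomial"
begin

section \<open>Oracle programs\<close>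

text \<open>
  The model of computation is a random access machine with structured control: finitely many
  registers, a memory of natural numbers with indirect addressing, and a query instruction. The
  arithmetic is addition and truncated subtraction only. Without multiplication, the values
  computed in \<open>t\<close> unit-cost steps have \<open>O(t)\<close> bits more than the input (for a fixed program), so
  polynomial time here is polynomial time on Turing machines. Programs are deterministic.
\<close>

datatype aexp =
    Const nat
  | Reg nat
  | Load aexp
  | Add aexp aexp
  | Monus aexp aexp

datatype com =
    Skip
  | Assign nat aexp
  | Store aexp aexp
  | Query nat aexp aexp
  | Seq com com
  | If aexp com com
  | While aexp com

type_synonym state = "(nat \<Rightarrow> nat) \<times> (nat \<Rightarrow> nat)"

fun aval :: "aexp \<Rightarrow> state \<Rightarrow> nat" where
  "aval (Const k) s = k"
| "aval (Reg i) s = fst s i"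
| "aval (Load a) s = snd s (aval a s)"
| "aval (Add a b) s = aval a s + aval b s"
| "aval (Monus a b) s = aval a s - aval b s"

text \<open>
  \<open>exec ans c s s' t qs\<close>: started in \<open>s\<close>, the program \<open>c\<close> halts in \<open>s'\<close> after \<open>t\<close> steps, having
  made the queries \<open>qs\<close> in this order. A query to \<open>x, y\<close> is recorded as the unordered pair
  \<open>{x, y}\<close> and is answered by \<open>ans {x, y}\<close>, where \<open>True\<close> claims "same cluster". An expression counts
  as true if its value is not \<open>0\<close>. Expressions are evaluated within the step in which they occur,
  since their size is a constant of the program.
\<close>

inductive exec ::
  "(nat set \<Rightarrow> bool) \<Rightarrow> com \<Rightarrow> state \<Rightarrow> state \<Rightarrow> nat \<Rightarrow> nat set list \<Rightarrow> bool"
  for ans :: "nat set \<Rightarrow> bool" where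
  Skip: "exec ans Skip s s 1 []"
| Assign: "exec ans (Assign i a) s ((fst s)(i := aval a s), snd s) 1 []"
| Store: "exec ans (Store a b) s (fst s, (snd s)(aval a s := aval b s)) 1 []"
| Query: "exec ans (Query i a b) s
    ((fst s)(i := (if ans {aval a s, aval b s} then 1 else 0)), snd s) 1 [{aval a s, aval b s}]"
| Seq: "exec ans c1 s1 s2 t1 qs1 \<Longrightarrow> exec ans c2 s2 s3 t2 qs2 \<Longrightarrow>
    exec ans (Seq c1 c2) s1 s3 (t1 + t2) (qs1 @ qs2)"
| If_true: "aval a s \<noteq> 0 \<Longrightarrow> exec ans c1 s s' t qs \<Longrightarrow> exec ans (If a c1 c2) s s' (Suc t) qs"
| If_false: "aval a s = 0 \<Longrightarrow> exec ans c2 s s' t qs \<Longrightarrow> exec ans (If a c1 c2) s s' (Suc t) qs"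
| While_false: "aval a s = 0 \<Longrightarrow> exec ans (While a c) s s 1 []"
| While_true: "aval a s1 \<noteq> 0 \<Longrightarrow> exec ans c s1 s2 t1 qs1 \<Longrightarrow>
    exec ans (While a c) s2 s3 t2 qs2 \<Longrightarrow>
    exec ans (While a c) s1 s3 (Suc (t1 + t2)) (qs1 @ qs2)"

inductive_cases exec_SkipE: "exec ans Skip s s' t qs"
inductive_cases exec_AssignE: "exec ans (Assign i a) s s' t qs"
inductive_cases exec_StoreE: "exec ans (Store a b) s s' t qs"
inductive_cases exec_QueryE: "exec ans (Query i a b) s s' t qs"
inductive_cases exec_SeqE: "exec ans (Seq c1 c2) s s' t qs"
inductive_cases exec_IfE: "exec ans (If a c1 c2) s s' t qs"
inductive_cases exec_WhileE: "exec ans (While a c) s s' t qs"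

lemma exec_deterministic:
  assumes "exec ans c s s1 t1 qs1" and "exec ans c s s2 t2 qs2"
  shows "s1 = s2 \<and> t1 = t2 \<and> qs1 = qs2"
  using assms
proof (induction arbitrary: s2 t2 qs2 rule: exec.induct)
  case (Skip s)
  from Skip.prems show ?case by (rule exec_SkipE) simp
next
  case (Assign i a s)
  from Assign.prems show ?case by (rule exec_AssignE) simp
next
  case (Store a b s)
  from Store.prems show ?case by (rule exec_StoreE) simp
next
  case (Query i a b s)
  from Query.prems show ?case by (rule exec_QueryE) simp
next
  case (Seq c1 s1 s' t1 qs1 c2 s3 t2' qs2')
  from Seq.prems obtain u v w v' w' where
    "exec ans c1 s1 u v w" "exec ans c2 u s2 v' w'" "t2 = v + v'" "qs2 = w @ w'"
    by (rule exec_SeqE) simp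
  with Seq.IH(1)[of u v w] Seq.IH(2)[of s2 v' w'] show ?case by simp
next
  case (If_true a s c1 s' t qs c2)
  from If_true.prems obtain v where "exec ans c1 s s2 v qs2" "t2 = Suc v"
    by (rule exec_IfE) (use If_true.hyps in simp_all)
  with If_true.IH[of s2 v qs2] show ?case by simp
next
  case (If_false a s c2 s' t qs c1)
  from If_false.prems obtain v where "exec ans c2 s s2 v qs2" "t2 = Suc v"
    by (rule exec_IfE) (use If_false.hyps in simp_all)
  with If_false.IH[of s2 v qs2] show ?case by simp
next
  case (While_false a s c)
  from While_false.prems show ?case
    by (rule exec_WhileE) (use While_false.hyps in simp_all)
next
  case (While_true a s1 c s' t1 qs1 s3 t2' qs2')
  from While_true.prems obtain u v w v' w' where
    "exec ans c s1 u v w" "exec ans (While a c) u s2 v' w'"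
    "t2 = Suc (v + v')" "qs2 = w @ w'"
    by (rule exec_WhileE) (use While_true.hyps in simp_all)
  with While_true.IH(1)[of u v w] While_true.IH(2)[of s2 v' w'] show ?case by simp
qed

definition init :: "nat \<Rightarrow> state" where
  "init n = ((\<lambda>_. 0)(0 := n), \<lambda>_. 0)"

text \<open>The running time is measured in the number \<open>n\<close> of items, for arbitrary answers.\<close>

definition polynomial_time :: "com \<Rightarrow> bool" where
  "polynomial_time c \<longleftrightarrow>
     (\<exists>p :: nat poly. \<forall>n ans. \<exists>s t qs. exec ans c (init n) s t qs \<and> t \<le> poly p n)"

section \<open>Noisy clustering queries\<close>

definition pairs :: "nat \<Rightarrow> nat set set" where
  "pairs n = {e. e \<subseteq> {..<n} \<and> card e = 2}"

definition same_cluster :: "nat set \<Rightarrow> nat set \<Rightarrow> bool" where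
  "same_cluster R e \<longleftrightarrow> e \<subseteq> R \<or> e \<inter> R = {}"

lemma same_cluster_pair: "same_cluster R {x, y} \<longleftrightarrow> (x \<in> R \<longleftrightarrow> y \<in> R)"
  by (auto simp: same_cluster_def)

text \<open>
  \<open>\<eta> e\<close> says whether the answer for the pair \<open>e\<close> is correct. As no pair is queried twice, drawing
  all of \<open>\<eta>\<close> in advance is the same as drawing each answer when it is asked for.
\<close>

definition correctness :: "real \<Rightarrow> nat \<Rightarrow> (nat set \<Rightarrow> bool) pmf" where
  "correctness \<delta> n = Pi_pmf (pairs n) True (\<lambda>_. bernoulli_pmf ((1 + \<delta>) / 2))"

definition noisy_answer :: "nat set \<Rightarrow> (nat set \<Rightarrow> bool) \<Rightarrow> nat set \<Rightarrow> bool" where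
  "noisy_answer R \<eta> e = (if \<eta> e then same_cluster R e else \<not> same_cluster R e)"

text \<open>
  Every query is to a pair of distinct items (so the values of \<open>ans\<close> elsewhere are
  never seen), and no pair is queried twice.
\<close>

definition legal_queries :: "com \<Rightarrow> bool" where
  "legal_queries c \<longleftrightarrow>
     (\<forall>n ans s t qs. exec ans c (init n) s t qs \<longrightarrow> set qs \<subseteq> pairs n \<and> distinct qs)"

definition queries_at_most :: "com \<Rightarrow> nat \<Rightarrow> real \<Rightarrow> bool" where
  "queries_at_most c n b \<longleftrightarrow>
     (\<forall>ans s t qs. exec ans c (init n) s t qs \<longrightarrow> real (length qs) \<le> b)"

text \<open>The output is the labelling of item \<open>i\<close> by whether memory cell \<open>i\<close> is \<open>0\<close>.\<close>

definition output_partition :: "nat \<Rightarrow> state \<Rightarrow> nat set set" where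
  "output_partition n s = {{i. i < n \<and> snd s i = 0}, {i. i < n \<and> snd s i \<noteq> 0}}"

definition recovers :: "com \<Rightarrow> nat \<Rightarrow> nat set \<Rightarrow> (nat set \<Rightarrow> bool) \<Rightarrow> bool" where
  "recovers c n R ans \<longleftrightarrow>
     (\<exists>s t qs. exec ans c (init n) s t qs \<and> output_partition n s = {R, {..<n} - R})"

end

theory Submission
  imports Defs "HOL-Real_Asymp.Real_Asymp"
begin

text \<open>
  Fix the item \<open>0\<close> as a reference. For a witness \<open>z\<close>, the answers to \<open>{0, z}\<close> and \<open>{y, z}\<close> agree with
  probability \<open>(1 + \<delta>\<^sup>2) / 2\<close> if \<open>0\<close> and \<open>y\<close> are in the same cluster and \<open>(1 - \<delta>\<^sup>2) / 2\<close> if not, and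
  for different witnesses these events are independent. So a majority vote over
  \<open>m = K \<lceil>log\<^sub>2 n\<rceil>\<close> witnesses with \<open>K \<ge> 4 / \<delta>\<^sup>4\<close> is wrong with probability at most \<open>n\<^sup>-\<^sup>2\<close> by
  Hoeffding's inequality, and a union bound over \<open>y\<close> finishes the proof. This costs \<open>(n + 2) m\<close>
  queries. For fixed \<open>\<delta>\<close>, the factor \<open>\<delta> powr - L\<close> tends to infinity, so it absorbs the constant
  \<open>K\<close> from some \<open>n0\<close> on; below \<open>n0\<close> the program asks nothing.
\<close>

section \<open>Total correctness with cost\<close>

text \<open>The time is only bounded from above, but the query list \<open>qs\<close> is exact. The
  number, the range and the distinctness of the queries can therefore all be read off from one
  derivation.\<close>

definition wp :: "(nat set \<Rightarrow> bool) \<Rightarrow> com \<Rightarrow> nat \<Rightarrow> nat set list \<Rightarrow> (state \<Rightarrow> bool) \<Rightarrow> state \<Rightarrow> bool" where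
  "wp ans c T qs Q s \<longleftrightarrow> (\<exists>s' t. exec ans c s s' t qs \<and> t \<le> T \<and> Q s')"

lemma wp_weaken:
  "wp ans c T qs Q s \<Longrightarrow> T \<le> T' \<Longrightarrow> qs = qs' \<Longrightarrow> (\<And>s. Q s \<Longrightarrow> Q' s) \<Longrightarrow> wp ans c T' qs' Q' s"
  unfolding wp_def by (meson le_trans)

lemma wp_cost:
  "wp ans c T qs Q s \<Longrightarrow> T \<le> T' \<Longrightarrow> qs = qs' \<Longrightarrow> wp ans c T' qs' Q s"
  by (rule wp_weaken)

lemma wp_Skip: "Q s \<Longrightarrow> wp ans Skip 1 [] Q s"
  unfolding wp_def by (blast intro: exec.Skip)

lemma wp_Assign: "Q ((fst s)(i := aval a s), snd s) \<Longrightarrow> wp ans (Assign i a) 1 [] Q s"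
  unfolding wp_def by (blast intro: exec.Assign)

lemma wp_Store: "Q (fst s, (snd s)(aval a s := aval b s)) \<Longrightarrow> wp ans (Store a b) 1 [] Q s"
  unfolding wp_def by (blast intro: exec.Store)

lemma wp_Query:
  "Q ((fst s)(i := (if ans {aval a s, aval b s} then 1 else 0)), snd s) \<Longrightarrow>
     wp ans (Query i a b) 1 [{aval a s, aval b s}] Q s"
  unfolding wp_def by (blast intro: exec.Query)

lemma wp_Seq:
  "wp ans c1 T1 qs1 (wp ans c2 T2 qs2 Q) s \<Longrightarrow> wp ans (Seq c1 c2) (T1 + T2) (qs1 @ qs2) Q s"
  unfolding wp_def by (blast intro: exec.Seq add_mono)

lemma wp_If:
  assumes "aval a s \<noteq> 0 \<Longrightarrow> wp ans c1 T1 qs Q s" and "aval a s = 0 \<Longrightarrow> wp ans c2 T2 qs Q s"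
  shows "wp ans (If a c1 c2) (Suc (max T1 T2)) qs Q s"
proof (cases "aval a s = 0")
  case True
  with assms(2) obtain s' t where "exec ans c2 s s' t qs" "t \<le> T2" "Q s'"
    unfolding wp_def by blast
  with True show ?thesis
    unfolding wp_def by (intro exI[of _ s'] exI[of _ "Suc t"]) (auto intro: exec.If_false)
next
  case False
  with assms(1) obtain s' t where "exec ans c1 s s' t qs" "t \<le> T1" "Q s'"
    unfolding wp_def by blast
  with False show ?thesis
    unfolding wp_def by (intro exI[of _ s'] exI[of _ "Suc t"]) (auto intro: exec.If_true)
qed

text \<open>The number \<open>N\<close> of rounds is known in advance, so an invariant indexed by
  the round replaces a termination measure. A round costs its body plus one test; the outer
  \<open>Suc\<close> pays for the final failing test.\<close>

lemma wp_While:
  assumes step: "\<And>i s. i < N \<Longrightarrow> I i s \<Longrightarrow> aval a s \<noteq> 0 \<and> wp ans c T (q i) (I (Suc i)) s"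
    and exit: "\<And>s. I N s \<Longrightarrow> aval a s = 0"
    and init: "I 0 s"
  shows "wp ans (While a c) (Suc (N * Suc T)) (concat (map q [0..<N])) (I N) s"
proof -
  have "wp ans (While a c) (Suc ((N - k) * Suc T)) (concat (map q [k..<N])) (I N) s"
    if "k \<le> N" "I k s" for k s
    using that
  proof (induction k arbitrary: s rule: inc_induct)
    case base
    then show ?case
      using exec.While_false[OF exit[OF base]] unfolding wp_def by fastforce
  next
    case (step k)
    from assms(1)[OF step.hyps(2) step.prems]
    obtain s1 t1 where s1: "aval a s \<noteq> 0" "exec ans c s s1 t1 (q k)" "t1 \<le> T" "I (Suc k) s1"
      by (auto simp: wp_def)
    from step.IH[OF s1(4)] obtain s2 t2 where s2:
      "exec ans (While a c) s1 s2 t2 (concat (map q [Suc k..<N]))"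
      "t2 \<le> Suc ((N - Suc k) * Suc T)" "I N s2"
      by (auto simp: wp_def)
    have "N - k = Suc (N - Suc k)"
      using step.hyps by simp
    then have "Suc (t1 + t2) \<le> Suc ((N - k) * Suc T)"
      using s1(3) s2(2) by simp
    moreover have "q k @ concat (map q [Suc k..<N]) = concat (map q [k..<N])"
      using step.hyps by (simp add: upt_conv_Cons)
    ultimately show ?case
      using exec.While_true[OF s1(1,2) s2(1)] s2(3) unfolding wp_def by metis
  qed
  from this[of 0] init show ?thesis by simp
qed

section \<open>The program\<close>

text \<open>
  Registers: 0 holds \<open>n\<close>, 1 the number \<open>m\<close> of witnesses per item, 2 a power of two, 3 the current
  item, 4 the \<open>offset\<close> of its witnesses, 5 the position among them, 6 the last answer, 7 the number
  of agreements, 8 the stored answer to \<open>{0, z}\<close>. These answers are kept in the cells \<open>n + z\<close>,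
  out of the way of the output.
\<close>

definition voters_com :: "nat \<Rightarrow> com" where
  "voters_com K =
     Seq (Assign 2 (Const 1))
       (While (Monus (Reg 0) (Reg 2))
         (Seq (Assign 2 (Add (Reg 2) (Reg 2))) (Assign 1 (Add (Reg 1) (Const K)))))"

text \<open>All witness blocks lie in \<open>{1..3 * m}\<close>, so these \<open>3 * m\<close>
  answers serve every vote. Storing them lets the votes share them without repeating a
  query.\<close>

definition reference_com :: com where
  "reference_com =
     While (Monus (Add (Reg 1) (Add (Reg 1) (Reg 1))) (Reg 3))
       (Seq (Assign 3 (Add (Reg 3) (Const 1)))
       (Seq (Query 6 (Const 0) (Reg 3))
         (Store (Add (Reg 0) (Reg 3)) (Reg 6))))"

text \<open>Subtraction is truncated, so \<open>(a - b) + (b - a)\<close> is \<open>0\<close>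
  exactly if \<open>a = b\<close>. The test thus detects that the two answers disagree.\<close>

definition vote_com :: com where
  "vote_com =
     While (Monus (Reg 1) (Reg 5))
       (Seq (Assign 5 (Add (Reg 5) (Const 1)))
       (Seq (Assign 8 (Load (Add (Reg 0) (Add (Reg 4) (Reg 5)))))
       (Seq (Query 6 (Reg 3) (Add (Reg 4) (Reg 5)))
         (If (Add (Monus (Reg 6) (Reg 8)) (Monus (Reg 8) (Reg 6)))
           Skip
           (Assign 7 (Add (Reg 7) (Const 1)))))))"

text \<open>The truncated difference written to the cell of the current item is \<open>0\<close>
  exactly if at least half of its witnesses agree, so \<open>0\<close> stands for the cluster of
  item 0.\<close>

definition label_com :: com where
  "label_com =
     Seq (If (Monus (Reg 3) (Add (Reg 1) (Reg 1))) (Assign 4 (Const 0))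
           (If (Monus (Reg 3) (Reg 1)) (Assign 4 (Add (Reg 1) (Reg 1))) (Assign 4 (Reg 1))))
    (Seq (Assign 5 (Const 0))
    (Seq (Assign 7 (Const 0))
    (Seq vote_com
    (Seq (Store (Reg 3) (Monus (Reg 1) (Add (Reg 7) (Reg 7))))
      (Assign 3 (Add (Reg 3) (Const 1)))))))"

text \<open>\<open>K\<close> and \<open>n0\<close> are constants of the program text, so the real
  number \<delta> never enters the computation.\<close>

definition vote_alg :: "nat \<Rightarrow> nat \<Rightarrow> com" where
  "vote_alg K n0 =
     If (Monus (Const n0) (Reg 0)) Skip
      (Seq (voters_com K)
      (Seq reference_com
      (Seq (Assign 3 (Const 1))
        (While (Monus (Reg 0) (Reg 3)) label_com))))"

text \<open>For \<open>0 < n\<close> this is the binary logarithm rounded up, in the form in which a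
  doubling loop computes it.\<close>

definition log_ceil :: "nat \<Rightarrow> nat" where
  "log_ceil n = (LEAST k. n \<le> 2 ^ k)"

lemma le_two_power_log_ceil: "n \<le> 2 ^ log_ceil n"
  unfolding log_ceil_def by (rule LeastI[of _ n]) (simp add: less_imp_le)

lemma two_power_less: "k < log_ceil n \<Longrightarrow> 2 ^ k < n"
  unfolding log_ceil_def by (drule not_less_Least) simp

lemma log_ceil_le: "log_ceil n \<le> n"
  unfolding log_ceil_def by (rule Least_le) (simp add: less_imp_le)

text \<open>
  The witnesses of \<open>y\<close> are the \<open>m\<close> items after \<open>offset m y\<close>. The first block of \<open>m\<close> items is judged by
  the second, the second by the third, and all other items by the first. This cyclic choice
  ensures that no pair is asked twice.
\<close>

definition offset :: "nat \<Rightarrow> nat \<Rightarrow> nat" where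
  "offset m y = (if 2 * m < y then 0 else if m < y then 2 * m else m)"

text \<open>The argument \<open>j\<close> is the number of witnesses read so far, which makes this
  count the loop invariant of a vote.\<close>

definition agree :: "(nat set \<Rightarrow> bool) \<Rightarrow> nat \<Rightarrow> nat \<Rightarrow> nat \<Rightarrow> nat" where
  "agree ans y w j = card {z \<in> {w<..w + j}. ans {0, z} = ans {y, z}}"

lemma agree_0 [simp]: "agree ans y w 0 = 0"
  by (simp add: agree_def)

lemma agree_Suc:
  "agree ans y w (Suc j) = agree ans y w j + (if ans {0, w + Suc j} = ans {y, w + Suc j} then 1 else 0)"
proof -
  have "{z \<in> {w<..w + Suc j}. ans {0, z} = ans {y, z}} =
    (if ans {0, w + Suc j} = ans {y, w + Suc j} then {w + Suc j} else {}) \<union>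
    {z \<in> {w<..w + j}. ans {0, z} = ans {y, z}}"
    by (auto simp: le_Suc_eq)
  then show ?thesis by (simp add: agree_def)
qed

definition tally :: "(nat set \<Rightarrow> bool) \<Rightarrow> nat \<Rightarrow> nat \<Rightarrow> nat" where
  "tally ans m y = agree ans y (offset m y) m"

section \<open>Verification of the program\<close>

definition regs :: "nat \<Rightarrow> nat \<Rightarrow> state \<Rightarrow> bool" where
  "regs n m s \<longleftrightarrow> fst s 0 = n \<and> fst s 1 = m"

definition stored :: "(nat set \<Rightarrow> bool) \<Rightarrow> nat \<Rightarrow> nat \<Rightarrow> state \<Rightarrow> bool" where
  "stored ans n k s \<longleftrightarrow> (\<forall>z\<in>{1..k}. snd s (n + z) = (if ans {0, z} then 1 else 0))"

lemma wp_voters: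
  "wp ans (voters_com K) (2 + 3 * log_ceil n) []
     (\<lambda>s. regs n (K * log_ceil n) s \<and> fst s 3 = 0 \<and> snd s 0 = 0) (init n)"
proof -
  let ?I = "\<lambda>i s. regs n (K * i) s \<and> fst s 2 = 2 ^ i \<and> fst s 3 = 0 \<and> snd s 0 = (0::nat)"
  have "wp ans (While (Monus (Reg 0) (Reg 2))
          (Seq (Assign 2 (Add (Reg 2) (Reg 2))) (Assign 1 (Add (Reg 1) (Const K)))))
          (Suc (log_ceil n * Suc 2)) (concat (map (\<lambda>_. []) [0..<log_ceil n])) (?I (log_ceil n)) s"
    if "?I 0 s" for s
  proof (rule wp_While[where I = ?I, OF _ _ that], intro conjI)
    fix i s assume i: "i < log_ceil n" "?I i s"
    show "aval (Monus (Reg 0) (Reg 2)) s \<noteq> 0"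
      using i two_power_less[of i n] by (simp add: regs_def)
    show "wp ans (Seq (Assign 2 (Add (Reg 2) (Reg 2))) (Assign 1 (Add (Reg 1) (Const K)))) 2 []
      (?I (Suc i)) s"
      by (rule wp_cost, (rule wp_Seq wp_Assign)+) (use i in \<open>auto simp: regs_def\<close>)
  qed (use le_two_power_log_ceil[of n] in \<open>simp add: regs_def\<close>)
  note loop = this
  show ?thesis
    unfolding voters_com_def
    by (rule wp_weaken[OF wp_Seq[OF wp_Assign[OF loop]]]) (auto simp: regs_def init_def)
qed

lemma wp_reference:
  assumes "regs n m s" "fst s 3 = 0" "snd s 0 = 0" "0 < n"
  shows "wp ans reference_com (Suc (3 * m * 4)) (map (\<lambda>i. {0, Suc i}) [0..<3 * m])
     (\<lambda>s. regs n m s \<and> stored ans n (3 * m) s \<and> snd s 0 = 0) s"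
proof -
  let ?I = "\<lambda>i s. regs n m s \<and> fst s 3 = i \<and> stored ans n i s \<and> snd s 0 = 0"
  have "wp ans reference_com (Suc (3 * m * Suc 3)) (concat (map (\<lambda>i. [{0, Suc i}]) [0..<3 * m]))
     (?I (3 * m)) s"
    unfolding reference_com_def
  proof (rule wp_While[where I = ?I], intro conjI)
    fix i s assume i: "i < 3 * m" "?I i s"
    show "aval (Monus (Add (Reg 1) (Add (Reg 1) (Reg 1))) (Reg 3)) s \<noteq> 0"
      using i by (simp add: regs_def)
    show "wp ans (Seq (Assign 3 (Add (Reg 3) (Const 1)))
       (Seq (Query 6 (Const 0) (Reg 3)) (Store (Add (Reg 0) (Reg 3)) (Reg 6))))
       3 [{0, Suc i}] (?I (Suc i)) s"
      by (rule wp_cost, (rule wp_Seq wp_Assign wp_Query wp_Store)+)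
        (use i assms(4) in \<open>auto simp: regs_def stored_def le_Suc_eq\<close>)
  qed (use assms in \<open>auto simp: regs_def stored_def\<close>)
  then show ?thesis
    by (rule wp_weaken) (auto simp: concat_map_singleton)
qed

lemma wp_vote:
  assumes "regs n m s" "stored ans n (3 * m) s" "fst s 3 = y" "fst s 4 = w" "w \<le> 2 * m"
    "fst s 5 = 0" "fst s 7 = 0"
  shows "wp ans vote_com (Suc (m * 6)) (map (\<lambda>j. {y, w + Suc j}) [0..<m])
     (\<lambda>s'. regs n m s' \<and> snd s' = snd s \<and> fst s' 3 = y \<and> fst s' 7 = agree ans y w m) s"
proof -
  let ?I = "\<lambda>j s'. regs n m s' \<and> snd s' = snd s \<and> fst s' 3 = y \<and> fst s' 4 = w \<and>
    fst s' 5 = j \<and> fst s' 7 = agree ans y w j"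
  have "wp ans vote_com (Suc (m * Suc 5)) (concat (map (\<lambda>j. [{y, w + Suc j}]) [0..<m])) (?I m) s"
    unfolding vote_com_def
  proof (rule wp_While[where I = ?I], intro conjI)
    fix j s' assume j: "j < m" "?I j s'"
    show "aval (Monus (Reg 1) (Reg 5)) s' \<noteq> 0"
      using j by (simp add: regs_def)
    \<comment> \<open>From \<open>w \<le> 2 * m\<close> and \<open>j < m\<close>, the witness lies
      in \<open>{1..3 * m}\<close>, where the answers for item 0 are stored.\<close>
    have ref: "snd s (n + Suc (w + j)) = (if ans {0, Suc (w + j)} then 1 else 0)"
      using assms(2,5) j(1) unfolding stored_def by (elim ballE[where x = "Suc (w + j)"]) auto
    show "wp ans (Seq (Assign 5 (Add (Reg 5) (Const 1)))
       (Seq (Assign 8 (Load (Add (Reg 0) (Add (Reg 4) (Reg 5)))))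
       (Seq (Query 6 (Reg 3) (Add (Reg 4) (Reg 5)))
         (If (Add (Monus (Reg 6) (Reg 8)) (Monus (Reg 8) (Reg 6)))
           Skip
           (Assign 7 (Add (Reg 7) (Const 1)))))))
       5 [{y, w + Suc j}] (?I (Suc j)) s'"
      by (rule wp_cost, (rule wp_Seq wp_Assign wp_Query)+, (rule wp_If; rule wp_Skip wp_Assign))
        (use j ref in \<open>auto simp: regs_def agree_Suc split: if_splits\<close>)
  qed (use assms in \<open>auto simp: regs_def\<close>)
  then show ?thesis
    by (rule wp_weaken) (auto simp: concat_map_singleton)
qed

definition vote_queries :: "nat \<Rightarrow> nat \<Rightarrow> nat set list" where
  "vote_queries m y = map (\<lambda>j. {y, offset m y + Suc j}) [0..<m]"

lemma wp_label:
  assumes "regs n m s" "stored ans n (3 * m) s" "fst s 3 = y" "y < n"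
  shows "wp ans label_com (8 + m * 6) (vote_queries m y)
     (\<lambda>s'. regs n m s' \<and> fst s' 3 = Suc y \<and>
        snd s' = (snd s)(y := m - (tally ans m y + tally ans m y))) s"
proof -
  let ?P = "\<lambda>s'. regs n m s' \<and> snd s' = snd s \<and> fst s' 3 = y"
  have offset: "wp ans
      (If (Monus (Reg 3) (Add (Reg 1) (Reg 1))) (Assign 4 (Const 0))
           (If (Monus (Reg 3) (Reg 1)) (Assign 4 (Add (Reg 1) (Reg 1))) (Assign 4 (Reg 1)))) 3 []
      (\<lambda>s'. ?P s' \<and> fst s' 4 = offset m y) s"
    by (rule wp_cost, (rule wp_If; (rule wp_Assign | (rule wp_If; rule wp_Assign))))
      (use assms in \<open>auto simp: regs_def offset_def\<close>)
  have vote: "wp ans vote_com (Suc (m * 6)) (vote_queries m y)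
      (\<lambda>s'. ?P s' \<and> fst s' 7 = tally ans m y) s'"
    if "?P s'" "fst s' 4 = offset m y" "fst s' 5 = 0" "fst s' 7 = 0" for s'
    unfolding vote_queries_def
    by (rule wp_weaken, rule wp_vote[of n m s' ans y "offset m y"])
      (use that assms in \<open>auto simp: tally_def stored_def offset_def\<close>)
  have store: "wp ans (Seq (Store (Reg 3) (Monus (Reg 1) (Add (Reg 7) (Reg 7))))
      (Assign 3 (Add (Reg 3) (Const 1)))) 2 []
      (\<lambda>s'. regs n m s' \<and> fst s' 3 = Suc y \<and>
        snd s' = (snd s)(y := m - (tally ans m y + tally ans m y))) s'"
    if "?P s' \<and> fst s' 7 = tally ans m y" for s'
    by (rule wp_cost, (rule wp_Seq wp_Assign wp_Store)+) (use that in \<open>auto simp: regs_def\<close>)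
  have rest: "wp ans
      (Seq (Assign 5 (Const 0)) (Seq (Assign 7 (Const 0)) (Seq vote_com
        (Seq (Store (Reg 3) (Monus (Reg 1) (Add (Reg 7) (Reg 7))))
          (Assign 3 (Add (Reg 3) (Const 1)))))))
      (1 + (1 + (Suc (m * 6) + 2))) ([] @ [] @ vote_queries m y @ [])
      (\<lambda>s'. regs n m s' \<and> fst s' 3 = Suc y \<and>
        snd s' = (snd s)(y := m - (tally ans m y + tally ans m y))) s'"
    if "?P s' \<and> fst s' 4 = offset m y" for s'
    by (intro wp_Seq wp_Assign wp_weaken[OF vote order.refl refl store])
      (use that in \<open>auto simp: regs_def\<close>)
  have "wp ans label_com (3 + (1 + (1 + (Suc (m * 6) + 2)))) ([] @ ([] @ [] @ vote_queries m y @ []))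
     (\<lambda>s'. regs n m s' \<and> fst s' 3 = Suc y \<and>
        snd s' = (snd s)(y := m - (tally ans m y + tally ans m y))) s"
    unfolding label_com_def by (rule wp_Seq[OF wp_weaken[OF offset order.refl refl rest]])
  then show ?thesis by simp
qed

lemma wp_labels:
  assumes "regs n m s" "stored ans n (3 * m) s" "snd s 0 = 0" "fst s 3 = 1" "0 < n"
  shows "wp ans (While (Monus (Reg 0) (Reg 3)) label_com) (Suc ((n - 1) * (9 + m * 6)))
     (concat (map (\<lambda>i. vote_queries m (Suc i)) [0..<n - 1]))
     (\<lambda>s'. snd s' 0 = 0 \<and> (\<forall>y\<in>{1..<n}. snd s' y = m - (tally ans m y + tally ans m y))) s"
proof -
  let ?I = "\<lambda>i s'. regs n m s' \<and> stored ans n (3 * m) s' \<and> snd s' 0 = 0 \<and> fst s' 3 = Suc i \<and>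
    (\<forall>y\<in>{1..<Suc i}. snd s' y = m - (tally ans m y + tally ans m y))"
  have "wp ans (While (Monus (Reg 0) (Reg 3)) label_com) (Suc ((n - 1) * Suc (8 + m * 6)))
     (concat (map (\<lambda>i. vote_queries m (Suc i)) [0..<n - 1])) (?I (n - 1)) s"
  proof (rule wp_While[where I = ?I], intro conjI)
    fix i s' assume i: "i < n - 1" "?I i s'"
    show "aval (Monus (Reg 0) (Reg 3)) s' \<noteq> 0"
      using i by (simp add: regs_def)
    \<comment> \<open>The label goes to a cell below \<open>n\<close>, so the stored answers, which
      start above cell \<open>n\<close>, survive it.\<close>
    show "wp ans label_com (8 + m * 6) (vote_queries m (Suc i)) (?I (Suc i)) s'"
      by (rule wp_weaken, rule wp_label[of n m s' ans "Suc i"])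
        (use i in \<open>auto simp: stored_def less_Suc_eq\<close>)
  qed (use assms in \<open>auto simp: regs_def\<close>)
  then show ?thesis
    by (rule wp_weaken) (use assms(5) in auto)
qed

text \<open>No answer occurs here: the algorithm is nonadaptive, so its legality and its number of
  queries are properties of a fixed list.\<close>

definition alg_queries :: "nat \<Rightarrow> nat \<Rightarrow> nat set list" where
  "alg_queries n m =
     map (\<lambda>i. {0, Suc i}) [0..<3 * m] @ concat (map (\<lambda>i. vote_queries m (Suc i)) [0..<n - 1])"

lemma wp_vote_alg:
  fixes n K :: nat
  defines "m \<equiv> K * log_ceil n"
  assumes "n0 \<le> n" "0 < n"
  shows "wp ans (vote_alg K n0) (6 + 3 * log_ceil n + 3 * m * 4 + (n - 1) * (9 + m * 6)) (alg_queries n m)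
     (\<lambda>s. snd s 0 = 0 \<and> (\<forall>y\<in>{1..<n}. snd s y = m - (tally ans m y + tally ans m y))) (init n)"
    (is "wp _ _ _ _ ?Q _")
proof -
  have "wp ans (Seq (Assign 3 (Const 1)) (While (Monus (Reg 0) (Reg 3)) label_com))
      (1 + Suc ((n - 1) * (9 + m * 6)))
      ([] @ concat (map (\<lambda>i. vote_queries m (Suc i)) [0..<n - 1])) ?Q s"
    if "regs n m s \<and> stored ans n (3 * m) s \<and> snd s 0 = 0" for s
    by (intro wp_Seq wp_Assign wp_labels) (use that assms in \<open>auto simp: regs_def stored_def\<close>)
  note 1 = this
  have "wp ans (Seq reference_com (Seq (Assign 3 (Const 1)) (While (Monus (Reg 0) (Reg 3)) label_com)))
      (Suc (3 * m * 4) + (1 + Suc ((n - 1) * (9 + m * 6))))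
      (map (\<lambda>i. {0, Suc i}) [0..<3 * m] @
        [] @ concat (map (\<lambda>i. vote_queries m (Suc i)) [0..<n - 1])) ?Q s"
    if "regs n m s \<and> fst s 3 = 0 \<and> snd s 0 = 0" for s
    by (rule wp_Seq[OF wp_weaken[OF wp_reference order.refl refl 1]]) (use that assms in auto)
  note 2 = this
  show ?thesis
    unfolding vote_alg_def
    \<comment> \<open>The branch that stops at once is unreachable because of
      \<open>n0 \<le> n\<close>, so its time bound can be set to \<open>0\<close>.\<close>
    by (rule wp_cost[OF wp_If[OF _ wp_Seq[OF wp_weaken[OF wp_voters order.refl refl 2]], where ?T1.0 = 0]])
      (use assms in \<open>auto simp: init_def alg_queries_def\<close>)
qed

lemma wp_vote_alg_small:
  assumes "n < n0"
  shows "wp ans (vote_alg K n0) 2 [] (\<lambda>s. True) (init n)"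
  unfolding vote_alg_def
  by (rule wp_cost, rule wp_If[where ?T2.0 = 0], rule wp_Skip) (use assms in \<open>auto simp: init_def\<close>)

section \<open>Number, range and distinctness of the queries\<close>

lemma length_alg_queries: "length (alg_queries n m) = 3 * m + (n - 1) * m"
  by (simp add: alg_queries_def vote_queries_def length_concat o_def sum_list_triv)

lemma set_vote_queries: "set (vote_queries m y) = (\<lambda>z. {y, z}) ` {offset m y<..offset m y + m}"
proof -
  have "z \<in> (\<lambda>j. offset m y + Suc j) ` {0..<m}" if "z \<in> {offset m y<..offset m y + m}" for z
    by (rule image_eqI[of _ _ "z - Suc (offset m y)"]) (use that in auto)
  then have "{offset m y<..offset m y + m} = (\<lambda>j. offset m y + Suc j) ` {0..<m}"
    by auto
  then show ?thesis
    by (simp add: vote_queries_def image_image)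
qed

lemma offset_not_mem: "y \<notin> {offset m y<..offset m y + m}"
  by (auto simp: offset_def)

lemma set_alg_queries: assumes "3 * m < n" shows "set (alg_queries n m) \<subseteq> pairs n"
proof -
  have "{y, z} \<in> pairs n" if "y < n" "z \<in> {offset m y<..offset m y + m}" for y z
    using that assms offset_not_mem[of y m]
    by (auto simp: pairs_def card_insert_if offset_def split: if_splits)
  then show ?thesis
    using assms by (auto simp: alg_queries_def set_vote_queries) (auto simp: pairs_def)
qed

text \<open>A pair shared by the votes on two items would make each a witness of the other.
  Witnesses follow the cycle from block 1 to 2 to 3 to 1, which has no 2-cycle, and items beyond the
  third block are never witnesses. The reference queries contain \<open>0\<close>, and the votes do
  not.\<close>

lemma distinct_alg_queries: "distinct (alg_queries n m)"
proof -
  have "distinct (concat (map (\<lambda>i. vote_queries m (Suc i)) [0..<n - 1]))"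
  proof -
    have dist: "distinct (vote_queries m y)" for y
      by (auto simp: vote_queries_def distinct_map inj_on_def doubleton_eq_iff)
    have disj: "set (vote_queries m y) \<inter> set (vote_queries m y') = {}" if "y \<noteq> y'" for y y'
      using that by (auto simp: set_vote_queries doubleton_eq_iff offset_def split: if_splits)
    have "distinct (concat (map (\<lambda>i. vote_queries m (Suc i)) [0..<k]))" for k
    proof (induction k)
      case (Suc k)
      have "set (vote_queries m (Suc i)) \<inter> set (vote_queries m (Suc k)) = {}" if "i < k" for i
        using that by (intro disj) simp
      with Suc show ?case by (fastforce simp: dist disjoint_iff)
    qed simp
    then show ?thesis .
  qed
  then show ?thesis
    by (auto simp: alg_queries_def distinct_map inj_on_def doubleton_eq_iff set_vote_queries)
qed

section \<open>Probability and asymptotics\<close>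

text \<open>For \<open>c = - ln \<delta>\<close> the exponential is the inverse of \<delta> to the
  power \<open>ln n / ln (ln n)\<close>. It is unbounded, hence eventually beats the constant factor
  \<open>K\<close>. The second bound ensures that all three witness blocks fit among the
  items.\<close>

lemma eventually_few_voters:
  fixes c K :: real assumes "c > 0" "K > 0"
  shows "eventually (\<lambda>n::nat. 2 * K * (1 + ln (real n) / ln 2) \<le>
           ln (real n) * exp (c * (ln (real n) / ln (ln (real n))))) sequentially"
    and "eventually (\<lambda>n::nat. 3 * K * (1 + ln (real n) / ln 2) < real n) sequentially"
  using assms by real_asymp+

text \<open>With signs, agreement of two bits becomes a product, whose expectation factors under
  independence.\<close>

definition spin :: "bool \<Rightarrow> real" where
  "spin b = (if b then 1 else - 1)"

text \<open>Each \<open>X z\<close> is a product of two independent spins of mean \<delta>, so it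
  has mean \<open>\<delta>\<^sup>2\<close>. Without a strict majority of agreements, the sum falls
  short of its mean by at least \<open>card W * \<delta>\<^sup>2\<close>, an event that Hoeffding's
  inequality bounds.\<close>

lemma agreement_tail:
  fixes e f :: "'i \<Rightarrow> 'a" and \<delta> :: real
  assumes fin: "finite A" "finite W" and W: "W \<noteq> {}"
    and inj: "inj_on e W" "inj_on f W" and disj: "e ` W \<inter> f ` W = {}"
    and sub: "e ` W \<subseteq> A" "f ` W \<subseteq> A" and \<delta>: "0 < \<delta>" "\<delta> < 1"
  shows "measure_pmf.prob (Pi_pmf A d (\<lambda>_. bernoulli_pmf ((1 + \<delta>) / 2)))
           {\<eta>. 2 * card {z \<in> W. \<eta> (e z) = \<eta> (f z)} \<le> card W} \<le> exp (- (card W * \<delta> ^ 4 / 2))"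
proof -
  define M where "M = Pi_pmf A d (\<lambda>_. bernoulli_pmf ((1 + \<delta>) / 2))"
  define X where "X = (\<lambda>z \<eta>. spin (\<eta> (e z)) * spin (\<eta> (f z)))"
  have coord: "prob_space.indep_vars M (\<lambda>_. count_space UNIV) (\<lambda>x \<eta>. \<eta> x) A"
    unfolding M_def by (rule indep_vars_Pi_pmf[OF fin(1)])
  have exp_spin: "measure_pmf.expectation M (\<lambda>\<eta>. spin (\<eta> x)) = \<delta>" if "x \<in> A" for x
  proof -
    have "measure_pmf.expectation M (\<lambda>\<eta>. spin (\<eta> x)) = measure_pmf.expectation (map_pmf (\<lambda>\<eta>. \<eta> x) M) spin"
      by simp
    also have "map_pmf (\<lambda>\<eta>. \<eta> x) M = bernoulli_pmf ((1 + \<delta>) / 2)"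
      unfolding M_def using fin(1) that by (simp add: Pi_pmf_component)
    finally show ?thesis using \<delta> by (simp add: spin_def field_simps)
  qed
  have integrable_spin: "integrable (measure_pmf M) (\<lambda>\<eta>. spin (g \<eta>))" for g
    by (rule measure_pmf.integrable_const_bound[where B = 1]) (auto simp: spin_def)
  have exp_X: "measure_pmf.expectation M (X z) = \<delta>\<^sup>2" if "z \<in> W" for z
  proof -
    have "e z \<noteq> f z" "e z \<in> A" "f z \<in> A" using that disj sub by auto
    then have "prob_space.indep_vars M (\<lambda>_. count_space UNIV) (\<lambda>x \<eta>. \<eta> x) {e z, f z}"
      by (intro prob_space.indep_vars_subset[OF measure_pmf.prob_space_axioms coord]) auto
    then have "prob_space.indep_vars M (\<lambda>_. borel) (\<lambda>x \<eta>. spin (\<eta> x)) {e z, f z}"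
      by (rule prob_space.indep_vars_compose2[OF measure_pmf.prob_space_axioms]) auto
    from prob_space.indep_vars_lebesgue_integral[OF measure_pmf.prob_space_axioms _ this] show ?thesis
      using \<open>e z \<noteq> f z\<close> \<open>e z \<in> A\<close> \<open>f z \<in> A\<close>
      by (simp add: X_def exp_spin integrable_spin power2_eq_square)
  qed
  \<comment> \<open>\<open>X z\<close> reads only the coordinates \<open>e z\<close> and
    \<open>f z\<close>. These two-element sets are disjoint for different \<open>z\<close>, which
    makes the products independent.\<close>
  have "prob_space.indep_vars M (\<lambda>z. PiM {e z, f z} (\<lambda>_. count_space UNIV)) (\<lambda>z \<eta>. \<lambda>x\<in>{e z, f z}. \<eta> x) W"
  proof (rule prob_space.indep_vars_restrict[OF measure_pmf.prob_space_axioms coord])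
    have "{e z, f z} \<inter> {e z', f z'} = {}" if "z \<in> W" "z' \<in> W" "z \<noteq> z'" for z z'
    proof -
      have "e z \<noteq> e z'" "f z \<noteq> f z'" using that inj by (auto dest: inj_onD)
      moreover have "e z \<noteq> f z'" "f z \<noteq> e z'"
        using that(1,2) disj by (metis IntI empty_iff imageI)+
      ultimately show ?thesis by simp
    qed
    then show "disjoint_family_on (\<lambda>z. {e z, f z}) W"
      by (simp add: disjoint_family_on_def)
  qed (use sub in auto)
  then have "prob_space.indep_vars M (\<lambda>_. borel) (\<lambda>z \<eta>. (\<lambda>\<omega>. spin (\<omega> (e z)) * spin (\<omega> (f z))) (\<lambda>x\<in>{e z, f z}. \<eta> x)) W"
    by (rule prob_space.indep_vars_compose2[OF measure_pmf.prob_space_axioms]) measurable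
  then have indep: "prob_space.indep_vars M (\<lambda>_. borel) X W"
    by (simp add: X_def)
  have "X z \<eta> \<in> {- 1..1}" for z \<eta>
    by (simp add: X_def spin_def)
  then have "Hoeffding_ineq (measure_pmf M) W X (\<lambda>_. - 1) (\<lambda>_. 1)"
    using fin(2) indep by unfold_locales simp_all
  \<comment> \<open>The deviation is the whole mean of the sum, which puts the threshold at
    \<open>0\<close>.\<close>
  from Hoeffding_ineq.Hoeffding_ineq_le[OF this, of "card W * \<delta>\<^sup>2"] fin W
  have Hoeffding: "measure_pmf.prob M {\<eta>. (\<Sum>z\<in>W. X z \<eta>) \<le> 0} \<le>
      exp (- 2 * (card W * \<delta>\<^sup>2)\<^sup>2 / (\<Sum>z\<in>W. (1 - - 1)\<^sup>2))"
    by (simp add: exp_X card_gt_0_iff)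
  have sum_X: "(\<Sum>z\<in>W. X z \<eta>) = 2 * real (card {z \<in> W. \<eta> (e z) = \<eta> (f z)}) - real (card W)" for \<eta>
  proof -
    have "(\<Sum>z\<in>W. X z \<eta>) = (\<Sum>z\<in>W. 2 * of_bool (\<eta> (e z) = \<eta> (f z)) - (1 :: real))"
      by (intro sum.cong) (auto simp: X_def spin_def)
    also have "\<dots> = 2 * (\<Sum>z\<in>W. of_bool (\<eta> (e z) = \<eta> (f z))) - real (card W)"
      by (simp add: sum_subtractf sum_distrib_left)
    finally show ?thesis using fin(2) by (simp add: Collect_conj_eq)
  qed
  have "{\<eta>. 2 * card {z \<in> W. \<eta> (e z) = \<eta> (f z)} \<le> card W} = {\<eta>. (\<Sum>z\<in>W. X z \<eta>) \<le> 0}"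
    unfolding sum_X by auto
  then have "measure_pmf.prob M {\<eta>. 2 * card {z \<in> W. \<eta> (e z) = \<eta> (f z)} \<le> card W} \<le>
      exp (- 2 * (card W * \<delta>\<^sup>2)\<^sup>2 / (\<Sum>z\<in>W. (1 - - 1)\<^sup>2))"
    using Hoeffding by (rule ord_eq_le_trans[OF arg_cong])
  also have "- 2 * (card W * \<delta>\<^sup>2)\<^sup>2 / (\<Sum>z\<in>W. (1 - - 1)\<^sup>2) = - (card W * \<delta> ^ 4 / 2)"
    using fin W by (simp add: power2_eq_square power4_eq_xxxx)
  finally show ?thesis unfolding M_def .
qed

section \<open>Correctness of the majority votes\<close>

text \<open>By determinism, the one run that \<open>wp\<close> provides is the only run. This is
  what statements about all runs, such as \<open>legal_queries\<close> and
  \<open>queries_at_most\<close>, require.\<close>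

lemma exec_unique:
  "wp ans c T qs' Q s \<Longrightarrow> exec ans c s s' t qs \<Longrightarrow> qs = qs' \<and> t \<le> T \<and> Q s'"
  unfolding wp_def using exec_deterministic by blast

lemma polynomial_time_vote_alg:
  assumes "0 < n0"
  shows "polynomial_time (vote_alg K n0)"
  unfolding polynomial_time_def
proof (rule exI, intro allI)
  fix n ans
  \<comment> \<open>The coefficients arise from the cost in \<open>wp_vote_alg\<close> by bounding
    \<open>log_ceil n\<close> by \<open>n\<close> and collecting powers of \<open>n\<close>.\<close>
  let ?p = "[:6, 12 + 12 * K, 6 * K:]"
  have "\<exists>T qs Q. wp ans (vote_alg K n0) T qs Q (init n) \<and> T \<le> poly ?p n"
  proof (cases "n < n0")
    case True
    have "2 \<le> poly ?p n"
      by simp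
    with wp_vote_alg_small[OF True] show ?thesis
      by blast
  next
    case False
    let ?m = "K * log_ceil n"
    have m: "?m \<le> K * n"
      by (rule mult_left_mono[OF log_ceil_le]) simp
    have "(n - 1) * (9 + ?m * 6) \<le> n * (9 + (K * n) * 6)"
      by (intro mult_le_mono add_le_mono log_ceil_le) simp_all
    then have "6 + 3 * log_ceil n + 3 * ?m * 4 + (n - 1) * (9 + ?m * 6) \<le>
        6 + 3 * n + 3 * (K * n) * 4 + n * (9 + (K * n) * 6)"
      using m log_ceil_le[of n] by linarith
    also have "\<dots> = poly ?p n"
      by (simp add: algebra_simps)
    finally have "6 + 3 * log_ceil n + 3 * ?m * 4 + (n - 1) * (9 + ?m * 6) \<le> poly ?p n" .
    moreover have "n0 \<le> n" "0 < n"
      using False assms by auto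
    ultimately show ?thesis
      using wp_vote_alg by blast
  qed
  then show "\<exists>s t qs. exec ans (vote_alg K n0) (init n) s t qs \<and> t \<le> poly ?p n"
    unfolding wp_def by (metis le_trans)
qed

lemma vote_alg_queries:
  assumes "0 < n0" and "exec ans (vote_alg K n0) (init n) s t qs"
  shows "qs = (if n < n0 then [] else alg_queries n (K * log_ceil n))"
  using assms exec_unique[OF wp_vote_alg_small assms(2)] exec_unique[OF wp_vote_alg assms(2)]
  by auto

text \<open>The cluster of \<open>z\<close> enters both answers and cancels. What remains is the
  agreement of the correctness bits, flipped if \<open>x\<close> and \<open>y\<close> are
  separated.\<close>

lemma noisy_answer_agree:
  "noisy_answer R \<eta> {x, z} = noisy_answer R \<eta> {y, z} \<longleftrightarrow>
     (\<eta> {x, z} = \<eta> {y, z}) = (x \<in> R \<longleftrightarrow> y \<in> R)"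
  by (auto simp: noisy_answer_def same_cluster_pair)

text \<open>The tally of \<open>y\<close> is the number of agreeing correctness bits if
  \<open>y\<close> shares the cluster of \<open>0\<close>, and \<open>m\<close> minus that number
  otherwise. The majority is strict because a tie puts \<open>y\<close> with
  \<open>0\<close>.\<close>

lemma recovers_vote_alg:
  fixes n K :: nat
  defines "m \<equiv> K * log_ceil n"
  assumes n: "n0 \<le> n" "0 < n" and R: "R \<subseteq> {..<n}"
    and majority: "\<And>y. y \<in> {1..<n} \<Longrightarrow>
      m < 2 * card {z \<in> {offset m y<..offset m y + m}. \<eta> {0, z} = \<eta> {y, z}}"
  shows "recovers (vote_alg K n0) n R (noisy_answer R \<eta>)"
proof -
  let ?ans = "noisy_answer R \<eta>"
  from wp_vote_alg[OF n, of ?ans K] obtain s t qs where exec: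
    "exec ?ans (vote_alg K n0) (init n) s t qs"
    and s: "snd s 0 = 0" "\<And>y. y \<in> {1..<n} \<Longrightarrow> snd s y = m - (tally ?ans m y + tally ?ans m y)"
    unfolding wp_def m_def by blast
  have "snd s y = 0 \<longleftrightarrow> (0 \<in> R \<longleftrightarrow> y \<in> R)" if y: "y \<in> {1..<n}" for y
  proof -
    let ?W = "{offset m y<..offset m y + m}"
    let ?G = "{z \<in> ?W. \<eta> {0, z} = \<eta> {y, z}}"
    show ?thesis
    proof (cases "0 \<in> R \<longleftrightarrow> y \<in> R")
      case True
      then have "tally ?ans m y = card ?G"
        by (simp add: tally_def agree_def noisy_answer_agree)
      with True majority[OF y] s(2)[OF y] show ?thesis by simp
    next
      case False
      have "card ?G \<le> card ?W"
        by (rule card_mono) auto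
      then have "card ?G \<le> m"
        by simp
      from False have "tally ?ans m y = card (?W - ?G)"
        unfolding tally_def agree_def noisy_answer_agree by (intro arg_cong[of _ _ card]) auto
      also have "\<dots> = m - card ?G"
        by (subst card_Diff_subset) auto
      finally have "tally ?ans m y + tally ?ans m y < m"
        using majority[OF y] \<open>card ?G \<le> m\<close> by linarith
      then show ?thesis
        using False s(2)[OF y] by simp
    qed
  qed
  then have zero: "snd s y = 0 \<longleftrightarrow> (0 \<in> R \<longleftrightarrow> y \<in> R)" if "y < n" for y
    using s(1) that by (cases "y = 0") auto
  have labels: "{i. i < n \<and> snd s i = 0} = {i. i < n \<and> (0 \<in> R \<longleftrightarrow> i \<in> R)}"
    "{i. i < n \<and> snd s i \<noteq> 0} = {i. i < n \<and> (0 \<in> R \<longleftrightarrow> i \<notin> R)}"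
    by (rule Collect_cong, metis zero)+
  have split: "{i. i < n \<and> i \<in> R} = R" "{i. i < n \<and> i \<notin> R} = {..<n} - R"
    using R by auto
  \<comment> \<open>The cells equal to \<open>0\<close> mark the cluster of item 0, which is
    \<open>R\<close> or its complement. Both cases give the same unordered partition.\<close>
  have "output_partition n s = {R, {..<n} - R}"
    unfolding output_partition_def labels
    by (cases "0 \<in> R") (simp_all add: split insert_commute)
  with exec show ?thesis unfolding recovers_def by blast
qed

section \<open>Failure probability of a vote and of the whole clustering\<close>

lemma finite_pairs: "finite (pairs n)"
  by (rule finite_subset[of _ "Pow {..<n}"]) (auto simp: pairs_def)

text \<open>This applies \<open>agreement_tail\<close> to the pairs \<open>{0, z}\<close> and
  \<open>{y, z}\<close>. The two families are disjoint because \<open>0\<close> is neither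
  \<open>y\<close> nor a witness.\<close>

lemma minority_prob:
  assumes \<delta>: "0 < \<delta>" "\<delta> < 1" and m: "0 < m" "3 * m < n" and y: "y \<in> {1..<n}"
  shows "measure_pmf.prob (correctness \<delta> n)
    {\<eta>. 2 * card {z \<in> {offset m y<..offset m y + m}. \<eta> {0, z} = \<eta> {y, z}} \<le> m} \<le>
    exp (- (m * \<delta> ^ 4 / 2))"
proof -
  let ?W = "{offset m y<..offset m y + m}"
  have W: "0 < z" "z < n" "z \<noteq> y" if "z \<in> ?W" for z
    using that m offset_not_mem[of y m] by (auto simp: offset_def split: if_splits)
  have "measure_pmf.prob (correctness \<delta> n)
    {\<eta>. 2 * card {z \<in> ?W. \<eta> ((\<lambda>z. {0, z}) z) = \<eta> ((\<lambda>z. {y, z}) z)} \<le> card ?W} \<le>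
    exp (- (card ?W * \<delta> ^ 4 / 2))"
    unfolding correctness_def
  proof (rule agreement_tail)
    show "(\<lambda>z. {0, z}) ` ?W \<inter> (\<lambda>z. {y, z}) ` ?W = {}"
      using W(1) y by (fastforce simp: doubleton_eq_iff)
    show "(\<lambda>z. {0, z}) ` ?W \<subseteq> pairs n" "(\<lambda>z. {y, z}) ` ?W \<subseteq> pairs n"
      using W y by (fastforce simp: pairs_def card_insert_if)+
  qed (use \<delta> m finite_pairs in \<open>auto simp: inj_on_def doubleton_eq_iff\<close>)
  then show ?thesis by simp
qed

lemma ln_le_log_ceil: "0 < n \<Longrightarrow> ln (real n) \<le> real (log_ceil n)"
proof -
  assume n: "0 < n"
  have "real n \<le> 2 ^ log_ceil n"
    using le_two_power_log_ceil[of n] by (metis of_nat_le_iff of_nat_numeral of_nat_power)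
  then have "ln (real n) \<le> ln (2 ^ log_ceil n)"
    using n by simp
  also have "\<dots> = real (log_ceil n) * ln 2"
    by (simp add: ln_realpow)
  also have "\<dots> \<le> real (log_ceil n) * 1"
    using ln_le_minus_one[of "2 :: real"] by (intro mult_left_mono) auto
  finally show ?thesis by simp
qed

lemma log_ceil_le_ln: "0 < n \<Longrightarrow> real (log_ceil n) \<le> 1 + ln (real n) / ln 2"
proof (cases "log_ceil n")
  case (Suc k)
  assume n: "0 < n"
  have "2 ^ k < real n"
    using two_power_less[of k n] Suc by (metis lessI of_nat_less_iff of_nat_numeral of_nat_power)
  then have "ln (2 ^ k) \<le> ln (real n)"
    by (intro ln_mono) auto
  then show ?thesis
    using Suc by (simp add: ln_realpow field_simps)
qed simp

lemma recovers_prob: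
  assumes \<delta>: "0 < \<delta>" "\<delta> < 1" and K: "4 / \<delta> ^ 4 \<le> real K" and n: "n0 \<le> n" "2 \<le> n"
    and m: "3 * (K * log_ceil n) < n" and R: "R \<subseteq> {..<n}"
  shows "1 - 1 / real n \<le>
    measure_pmf.prob (correctness \<delta> n) {\<eta>. recovers (vote_alg K n0) n R (noisy_answer R \<eta>)}"
proof -
  let ?m = "K * log_ceil n"
  let ?P = "measure_pmf.prob (correctness \<delta> n)"
  define bad where
    "bad y = {\<eta> :: nat set \<Rightarrow> bool. 2 * card {z \<in> {offset ?m y<..offset ?m y + ?m}. \<eta> {0, z} = \<eta> {y, z}} \<le> ?m}" for y
  let ?good = "{\<eta>. recovers (vote_alg K n0) n R (noisy_answer R \<eta>)}"
  have ln_pos: "0 < ln (real n)" using n by simp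
  have K': "4 \<le> real K * \<delta> ^ 4"
    using K \<delta> by (simp add: field_simps)
  \<comment> \<open>The factor 4 in the bound on \<open>K\<close> makes the Hoeffding exponent at
    least \<open>2 * ln n\<close>, so that \<open>1 / n\<close> is left after the union
    bound.\<close>
  have "4 * ln (real n) \<le> real K * \<delta> ^ 4 * real (log_ceil n)"
    using K' ln_le_log_ceil[of n] n ln_pos by (intro mult_mono) auto
  then have m_large: "2 * ln (real n) \<le> real ?m * \<delta> ^ 4 / 2"
    by (simp add: mult_ac)
  have m_pos: "0 < ?m"
  proof (rule ccontr)
    assume "\<not> 0 < ?m"
    then have "real ?m = 0" by simp
    with m_large ln_pos show False by (simp only: mult_zero_left div_0)
  qed
  have "?P (- ?good) \<le> ?P (\<Union>y\<in>{1..<n}. bad y)"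
  proof (rule measure_pmf.finite_measure_mono)
    have "\<eta> \<in> ?good" if "\<forall>y\<in>{1..<n}. \<eta> \<notin> bad y" for \<eta>
    proof -
      have "recovers (vote_alg K n0) n R (noisy_answer R \<eta>)"
      proof (rule recovers_vote_alg[OF n(1) _ R])
        show "0 < n"
          using n(2) by simp
        show "?m < 2 * card {z \<in> {offset ?m y<..offset ?m y + ?m}. \<eta> {0, z} = \<eta> {y, z}}"
          if "y \<in> {1..<n}" for y
          using that \<open>\<forall>y\<in>{1..<n}. \<eta> \<notin> bad y\<close> unfolding bad_def mem_Collect_eq not_le by (rule bspec[rotated])
      qed
      then show ?thesis by simp
    qed
    then show "- ?good \<subseteq> (\<Union>y\<in>{1..<n}. bad y)"
      by blast
  qed simp
  also have "\<dots> \<le> (\<Sum>y\<in>{1..<n}. ?P (bad y))"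
    by (rule measure_pmf.finite_measure_subadditive_finite) auto
  also have "\<dots> \<le> (\<Sum>y\<in>{1..<n}. 1 / real n ^ 2)"
  proof (rule sum_mono)
    fix y assume "y \<in> {1..<n}"
    then have "?P (bad y) \<le> exp (- (?m * \<delta> ^ 4 / 2))"
      unfolding bad_def using \<delta> m m_pos by (intro minority_prob)
    also have "\<dots> \<le> exp (- (2 * ln (real n)))"
      using m_large by simp
    also have "\<dots> = 1 / real n ^ 2"
      using n by (simp add: exp_minus exp_double inverse_eq_divide)
    finally show "?P (bad y) \<le> 1 / real n ^ 2" .
  qed
  also have "\<dots> = real (n - 1) * (1 / real n ^ 2)"
    by simp
  also have "\<dots> \<le> real n * (1 / real n ^ 2)"
    by (intro mult_right_mono) auto
  also have "\<dots> = 1 / real n"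
    by (simp add: power2_eq_square)
  finally have "?P (- ?good) \<le> 1 / real n" .
  moreover have "?P (- ?good) = 1 - ?P ?good"
    using measure_pmf.prob_compl[of ?good "correctness \<delta> n"] by (simp add: Compl_eq_Diff_UNIV)
  ultimately show ?thesis by simp
qed

theorem theorem5:
  "\<exists>C > 0. \<forall>\<delta> :: real. 0 < \<delta> \<and> \<delta> < 1 \<longrightarrow>
     (\<exists>alg.
        polynomial_time alg \<and>
        legal_queries alg \<and>
        (\<forall>n \<ge> 3. queries_at_most alg n
           (C * (real n * ln (real n) / \<delta> powr (ln (real n) / ln (ln (real n)))))) \<and>
        (\<forall>R :: nat \<Rightarrow> nat set. (\<forall>n. R n \<subseteq> {..<n}) \<longrightarrow>
           (\<lambda>n. measure_pmf.prob (correctness \<delta> n)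
                  {\<eta>. recovers alg n (R n) (noisy_answer (R n) \<eta>)}) \<longlonglongrightarrow> 1))"
proof (intro exI[of _ 1] conjI allI impI, simp, elim conjE)
  fix \<delta> :: real assume \<delta>: "0 < \<delta>" "\<delta> < 1"
  define K where "K = nat \<lceil>4 / \<delta> ^ 4\<rceil>"
  let ?c = "- ln \<delta>" and ?m = "\<lambda>n. K * log_ceil n"
  have K: "4 / \<delta> ^ 4 \<le> real K"
    unfolding K_def by (rule real_nat_ceiling_ge)
  have "0 < 4 / \<delta> ^ 4"
    using \<delta> by simp
  with K have "0 < real K" by linarith
  moreover have "0 < ?c" using \<delta> by simp
  ultimately have "\<forall>\<^sub>F n in sequentially.
      2 * real K * (1 + ln (real n) / ln 2) \<le> ln (real n) * exp (?c * (ln (real n) / ln (ln (real n)))) \<and>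
      3 * real K * (1 + ln (real n) / ln 2) < real n \<and> 2 \<le> n"
    by (intro eventually_conj eventually_few_voters eventually_ge_at_top)
  \<comment> \<open>\<open>n0\<close> may depend on \<delta>, so it hides the dependence of
    \<open>K\<close> on \<delta>, and \<open>C = 1\<close> works for every \<delta>.\<close>
  then obtain n0 where n0: "\<And>n. n0 \<le> n \<Longrightarrow>
      2 * real K * (1 + ln (real n) / ln 2) \<le> ln (real n) * exp (?c * (ln (real n) / ln (ln (real n)))) \<and>
      3 * real K * (1 + ln (real n) / ln 2) < real n \<and> 2 \<le> n"
    unfolding eventually_sequentially by blast
  have n0_pos: "0 < n0" using n0[of n0] by simp
  have few: "3 * ?m n < n" if "n0 \<le> n" for n
  proof -
    have "real (3 * ?m n) \<le> 3 * real K * (1 + ln (real n) / ln 2)"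
      using log_ceil_le_ln[of n] n0[OF that] by (simp add: mult_left_mono)
    with n0[OF that] have "real (3 * ?m n) < real n" by linarith
    then show ?thesis by (simp only: of_nat_less_iff)
  qed
  let ?alg = "vote_alg K n0"
  have "legal_queries ?alg"
    unfolding legal_queries_def
  proof (intro allI impI)
    fix n ans s t qs assume "exec ans ?alg (init n) s t qs"
    from vote_alg_queries[OF n0_pos this] show "set qs \<subseteq> pairs n \<and> distinct qs"
      using set_alg_queries[OF few, of n] distinct_alg_queries by simp
  qed
  moreover have "queries_at_most ?alg n
      (1 * (real n * ln (real n) / \<delta> powr (ln (real n) / ln (ln (real n)))))" if "3 \<le> n" for n
    unfolding queries_at_most_def
  proof (intro allI impI)
    fix ans s t qs assume exec: "exec ans ?alg (init n) s t qs"
    let ?B = "1 * (real n * ln (real n) / \<delta> powr (ln (real n) / ln (ln (real n))))"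
    show "real (length qs) \<le> ?B"
    proof (cases "n < n0")
      case True
      with vote_alg_queries[OF n0_pos exec] that show ?thesis by simp
    next
      case False
      then have "length qs = 3 * ?m n + (n - 1) * ?m n"
        using vote_alg_queries[OF n0_pos exec] by (simp add: length_alg_queries)
      \<comment> \<open>Bounding \<open>n + 2\<close> by \<open>2 * n\<close> is the source of the
        factor 2 in \<open>eventually_few_voters\<close>.\<close>
      also have "\<dots> = (n + 2) * ?m n"
        using that by (simp flip: add_mult_distrib)
      also have "\<dots> \<le> (2 * n) * ?m n"
        using that by (intro mult_right_mono) auto
      finally have "real (length qs) \<le> real ((2 * n) * ?m n)"
        by (simp only: of_nat_le_iff)
      also have "\<dots> = real n * (2 * real K * real (log_ceil n))"
        by simp
      also have "\<dots> \<le> real n * (2 * real K * (1 + ln (real n) / ln 2))"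
        using log_ceil_le_ln[of n] that by (intro mult_left_mono) auto
      also have "\<dots> \<le> real n * (ln (real n) * exp (?c * (ln (real n) / ln (ln (real n)))))"
        using n0[of n] False by (intro mult_left_mono) auto
      also have "\<dots> = ?B"
        using \<delta> by (simp add: powr_def exp_minus field_simps)
      finally show ?thesis .
    qed
  qed
  moreover have "(\<lambda>n. measure_pmf.prob (correctness \<delta> n)
      {\<eta>. recovers ?alg n (R n) (noisy_answer (R n) \<eta>)}) \<longlonglongrightarrow> 1"
    if R: "\<forall>n. R n \<subseteq> {..<n}" for R :: "nat \<Rightarrow> nat set"
  proof (rule tendsto_sandwich)
    \<comment> \<open>The bound of \<open>recovers_prob\<close> is uniform in \<open>R\<close>, so
      the sequence of partitions can be arbitrary.\<close>
    show "\<forall>\<^sub>F n in sequentially. 1 - 1 / real n \<le> measure_pmf.prob (correctness \<delta> n)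
        {\<eta>. recovers ?alg n (R n) (noisy_answer (R n) \<eta>)}"
      using eventually_ge_at_top[of n0]
      by eventually_elim (use recovers_prob[OF \<delta> K] n0 few R in blast)
    show "(\<lambda>n. 1 - 1 / real n) \<longlonglongrightarrow> 1"
      by real_asymp
  qed auto
  ultimately show "\<exists>alg. polynomial_time alg \<and> legal_queries alg \<and>
      (\<forall>n\<ge>3. queries_at_most alg n
        (1 * (real n * ln (real n) / \<delta> powr (ln (real n) / ln (ln (real n)))))) \<and>
      (\<forall>R :: nat \<Rightarrow> nat set. (\<forall>n. R n \<subseteq> {..<n}) \<longrightarrow>
        (\<lambda>n. measure_pmf.prob (correctness \<delta> n)
          {\<eta>. recovers alg n (R n) (noisy_answer (R n) \<eta>)}) \<longlonglongrightarrow> 1)"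
    using polynomial_time_vote_alg[OF n0_pos] by blast
qed

end
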